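(* For every positive integer $n$, put $m := \frac{1}{2}n(n+1)$. Then there is a real number $\lambda_n$ for which $$1 + \frac{1}{2} + \frac{1}{3} + \cdots + \frac{1}{n} = \frac{1}{2}\ln(2m) + \gamma + \frac{1}{12m + \frac{6}{5}} + \lambda_n,$$ where $$0 < \lambda_n < \frac{19}{25200m^3}.$$ In fact, $$\lambda_n = \frac{19}{25200m^3} - \rho_n, \qquad \text{where } 0 < \rho_n < \frac{43}{84000m^4}.$$ The constants $\frac{19}{25200}$ and $\frac{43}{84000}$ are the best possible, that is: there is no real $C < \frac{19}{25200}$ such that $\lambda_n < \frac{C}{m^3}$ for all positive integers $n$, and there is no real $C' < \frac{43}{84000}$ such that $\rho_n < \frac{C'}{m^4}$ for all positive integers $n$.
   Context: $\gamma = 0.57721\ldots$ denotes Euler's constant, and $\ln$ is the natural logarithm. Here $m$ depends on $n$ through $m = \frac{1}{2}n(n+1)$. *)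

theory Defs
  imports "HOL-Analysis.Analysis"
begin

definition tri :: "nat \<Rightarrow> real" where
  "tri n = real n * (real n + 1) / 2"

end

theory Submission imports Defs "HOL-Real_Asymp.Real_Asymp" begin

text \<open>
  Let \<open>e n\<close> be the error of \<open>ln (2 m) / 2 + \<gamma>\<close> as an approximation of the harmonic number. With
  \<open>x = n + 1\<close>, the step \<open>e n - e (n + 1)\<close> equals \<open>artanh (1 / x) - 1 / x\<close>, which truncations of the
  artanh series bound on both sides by rational functions. Comparing these with the steps of
  \<open>g\<^sub>K(m) = 1 / (12 m + 6 / 5) + 19 / (25200 m\<^sup>3) - 43 / (84000 m\<^sup>4) + K / m\<^sup>5\<close> shows that \<open>e - g\<^sub>0\<close>
  strictly decreases to 0 and \<open>e - g\<^sub>K\<close> strictly increases to 0 for \<open>K = 43 / 84000\<close>, so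
  \<open>g\<^sub>0 < e < g\<^sub>K\<close>. As \<open>m \<ge> 1\<close>, this \<open>K\<close> still gives \<open>\<rho> > 0\<close>, and the two bounds determine the
  leading coefficients of \<open>\<lambda>\<close> and \<open>\<rho>\<close>, whence the optimality.
\<close>

definition tri_approx :: "real \<Rightarrow> real \<Rightarrow> real" where
  "tri_approx K m = 1 / (12 * m + 6 / 5) + 19 / (25200 * m ^ 3) - 43 / (84000 * m ^ 4) + K / m ^ 5"

text \<open>For \<open>x = n + 1\<close>, the factors \<open>y = x - 1\<close> and
  \<open>y = x + 1\<close> give the consecutive arguments \<open>tri n\<close> and
  \<open>tri (Suc n)\<close>.\<close>

lemma tri_approx_half_product:
  "tri_approx K (x * y / 2) = 5 / (6 * (5 * (x * y) + 1))
    + 19 / (3150 * (x ^ 3 * y ^ 3)) - 43 / (5250 * (x ^ 4 * y ^ 4)) + 32 * K / (x ^ 5 * y ^ 5)"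
proof -
  have "12 * (x * y / 2) + 6 / 5 = 6 * (5 * (x * y) + 1) / 5"
    by simp
  then show ?thesis
    unfolding tri_approx_def by (simp only:) (simp add: power_divide power_mult_distrib)
qed

text \<open>The steps of \<open>tri_approx\<close> agree with artanh(1/x) - 1/x through order x^-9,
  and \<open>K\<close> only enters from x^-11 on. Both differences are therefore of order x^-11, and
  clearing denominators leaves polynomial inequalities on x \<ge> 2, which corresponds to n \<ge>
  1.\<close>

lemma tri_approx_step_bounds:
  fixes x :: real
  assumes "x \<ge> 2"
  shows "tri_approx 0 (x * (x - 1) / 2) - tri_approx 0 (x * (x + 1) / 2)
      < 1 / (3 * x ^ 3) + 1 / (5 * x ^ 5) + 1 / (7 * x ^ 7) + 1 / (9 * x ^ 9)"
    and "1 / (3 * x ^ 3) + 1 / (5 * x ^ 5) + 1 / (7 * x ^ 7) + 1 / (9 * x ^ 7 * ((x - 1) * (x + 1)))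
      < tri_approx (43 / 84000) (x * (x - 1) / 2) - tri_approx (43 / 84000) (x * (x + 1) / 2)"
proof -
  define y where "y = x - 2"
  define v where "v = x - 1"
  define w where "w = x + 1"
  define a where "a = 5 * (x * w) + 1"
  define b where "b = 5 * (x * v) + 1"
  \<comment> \<open>A common denominator of all fractions up to factors of 2: 7875 = 25 * 315, where
    315 = lcm(3, 5, 7, 9). Hence the half-integers in \<open>upper\<close> and
    \<open>lower\<close>.\<close>
  define D where "D = 7875 * (a * b * x ^ 9 * v ^ 5 * w ^ 5)"
  have y: "y \<ge> 0" and pos: "x > 0" "v > 0" "w > 0" "a > 0" "b > 0"
    using assms by (auto simp: y_def a_def b_def v_def w_def intro!: add_pos_pos)
  have D: "D > 0"
    using pos by (simp add: D_def)
  have nz: "x \<noteq> 0" "v \<noteq> 0" "w \<noteq> 0" "a \<noteq> 0" "b \<noteq> 0" "D \<noteq> 0"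
    using pos D by auto
  have series:
    "1 / (3 * x ^ 3) = 2625 * (a * b * x ^ 6 * v ^ 5 * w ^ 5) / D"
    "1 / (5 * x ^ 5) = 1575 * (a * b * x ^ 4 * v ^ 5 * w ^ 5) / D"
    "1 / (7 * x ^ 7) = 1125 * (a * b * x ^ 2 * v ^ 5 * w ^ 5) / D"
    "1 / (9 * x ^ 9) = 875 * (a * b * v ^ 5 * w ^ 5) / D"
    "1 / (9 * x ^ 7 * (v * w)) = 875 * (a * b * x ^ 2 * v ^ 4 * w ^ 4) / D"
    by (simp_all add: frac_eq_eq nz) (simp_all add: D_def eval_nat_numeral)
  have upper: "tri_approx K (x * w / 2) = (13125 / 2 * (b * x ^ 9 * v ^ 5 * w ^ 5)
      + 95 / 2 * (a * b * x ^ 6 * v ^ 5 * w ^ 2) - 129 / 2 * (a * b * x ^ 5 * v ^ 5 * w)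
      + 252000 * K * (a * b * x ^ 4 * v ^ 5)) / D" for K
  proof -
    have "5 / (6 * a) = 13125 / 2 * (b * x ^ 9 * v ^ 5 * w ^ 5) / D"
      "19 / (3150 * (x ^ 3 * w ^ 3)) = 95 / 2 * (a * b * x ^ 6 * v ^ 5 * w ^ 2) / D"
      "43 / (5250 * (x ^ 4 * w ^ 4)) = 129 / 2 * (a * b * x ^ 5 * v ^ 5 * w) / D"
      "32 * K / (x ^ 5 * w ^ 5) = 252000 * K * (a * b * x ^ 4 * v ^ 5) / D"
      by (simp_all add: frac_eq_eq nz) (simp_all add: D_def eval_nat_numeral)
    then show ?thesis
      unfolding tri_approx_half_product a_def[symmetric] by (simp add: add_divide_distrib diff_divide_distrib)
  qed
  have lower: "tri_approx K (x * v / 2) = (13125 / 2 * (a * x ^ 9 * v ^ 5 * w ^ 5)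
      + 95 / 2 * (a * b * x ^ 6 * v ^ 2 * w ^ 5) - 129 / 2 * (a * b * x ^ 5 * v * w ^ 5)
      + 252000 * K * (a * b * x ^ 4 * w ^ 5)) / D" for K
  proof -
    have "5 / (6 * b) = 13125 / 2 * (a * x ^ 9 * v ^ 5 * w ^ 5) / D"
      "19 / (3150 * (x ^ 3 * v ^ 3)) = 95 / 2 * (a * b * x ^ 6 * v ^ 2 * w ^ 5) / D"
      "43 / (5250 * (x ^ 4 * v ^ 4)) = 129 / 2 * (a * b * x ^ 5 * v * w ^ 5) / D"
      "32 * K / (x ^ 5 * v ^ 5) = 252000 * K * (a * b * x ^ 4 * w ^ 5) / D"
      by (simp_all add: frac_eq_eq nz) (simp_all add: D_def eval_nat_numeral)
    then show ?thesis
      unfolding tri_approx_half_product b_def[symmetric] by (simp add: add_divide_distrib diff_divide_distrib)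
  qed
  \<comment> \<open>After the shift to \<open>y = x - 2 \<ge> 0\<close> both numerators have only positive coefficients.\<close>
  have shift: "x = y + 2" "w = y + 3" "v = y + 1"
    "a = 5 * ((y + 2) * (y + 3)) + 1" "b = 5 * ((y + 2) * (y + 1)) + 1"
    by (simp_all add: y_def a_def b_def v_def w_def)
  note combine = series upper lower add_divide_distrib[symmetric] diff_divide_distrib[symmetric]
  \<comment> \<open>For K = 0 every remaining numerator over \<open>D\<close> is divisible by
    \<open>v * w\<close>, which is split off.\<close>
  have "1 / (3 * x ^ 3) + 1 / (5 * x ^ 5) + 1 / (7 * x ^ 7) + 1 / (9 * x ^ 9)
      - (tri_approx 0 (x * v / 2) - tri_approx 0 (x * w / 2))
    = (8850 * y ^ 10 + 177000 * y ^ 9 + 1644366 * y ^ 8 + 9317856 * y ^ 7 + 35394928 * y ^ 6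
      + 93249600 * y ^ 5 + 170889905 * y ^ 4 + 213412232 * y ^ 3 + 172844812 * y ^ 2
      + 81702896 * y + 17088075) * (v * w) / D" (is "_ = ?P * _ / D")
    unfolding combine
    unfolding shift by (rule arg_cong[where f = "\<lambda>t. t / D"], algebra)
  moreover have "?P * (v * w) / D > 0"
    using y D pos by (intro divide_pos_pos mult_pos_pos add_nonneg_pos) simp_all
  ultimately show "tri_approx 0 (x * (x - 1) / 2) - tri_approx 0 (x * (x + 1) / 2)
      < 1 / (3 * x ^ 3) + 1 / (5 * x ^ 5) + 1 / (7 * x ^ 7) + 1 / (9 * x ^ 9)"
    by (simp add: v_def w_def)
  \<comment> \<open>Here every numerator over \<open>D\<close> is divisible by
    \<open>x ^ 2\<close>.\<close>
  have "tri_approx (43 / 84000) (x * v / 2) - tri_approx (43 / 84000) (x * w / 2)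
    - (1 / (3 * x ^ 3) + 1 / (5 * x ^ 5) + 1 / (7 * x ^ 7) + 1 / (9 * x ^ 7 * (v * w)))
    = (1525 * y ^ 10 + 30500 * y ^ 9 + 377759 * y ^ 8 + 3116144 * y ^ 7 + 16618853 * y ^ 6
      + 57715772 * y ^ 5 + 131951351 * y ^ 4 + 197355896 * y ^ 3 + 186116590 * y ^ 2
      + 100525560 * y + 23723202) * x ^ 2 / D" (is "_ = ?Q * _ / D")
    unfolding combine
    unfolding shift by (rule arg_cong[where f = "\<lambda>t. t / D"], algebra)
  moreover have "?Q * x ^ 2 / D > 0"
    using y D pos by (intro divide_pos_pos mult_pos_pos add_nonneg_pos) simp_all
  ultimately show "1 / (3 * x ^ 3) + 1 / (5 * x ^ 5) + 1 / (7 * x ^ 7) + 1 / (9 * x ^ 7 * ((x - 1) * (x + 1)))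
      < tri_approx (43 / 84000) (x * (x - 1) / 2) - tri_approx (43 / 84000) (x * (x + 1) / 2)"
    by (simp add: v_def w_def)
qed

text \<open>The logarithm is 2 artanh(1/x), whose series has positive terms 2 / ((2k+1) x^(2k+1)).
  Five terms give the lower bound; for the upper bound, the tail after four terms is dominated by a
  geometric series of ratio 1/x^2.\<close>

lemma artanh_inverse_bounds:
  fixes x :: real
  assumes x: "x > 1"
  shows "1 / x + 1 / (3 * x ^ 3) + 1 / (5 * x ^ 5) + 1 / (7 * x ^ 7) + 1 / (9 * x ^ 9)
      \<le> ln ((x + 1) / (x - 1)) / 2"
    and "ln ((x + 1) / (x - 1)) / 2
      \<le> 1 / x + 1 / (3 * x ^ 3) + 1 / (5 * x ^ 5) + 1 / (7 * x ^ 7) + 1 / (9 * x ^ 7 * ((x - 1) * (x + 1)))"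
proof -
  have z: "(x + 1) / (x - 1) > 1"
    using x by simp
  have y: "((x + 1) / (x - 1) - 1) / ((x + 1) / (x - 1) + 1) = 1 / x"
    using x by (simp add: field_simps)
  show "1 / x + 1 / (3 * x ^ 3) + 1 / (5 * x ^ 5) + 1 / (7 * x ^ 7) + 1 / (9 * x ^ 9)
      \<le> ln ((x + 1) / (x - 1)) / 2"
    using ln_approx_bounds[OF z, of 5] unfolding y
    by (simp add: numeral_eq_Suc power_divide)
  have "1 - (1 / x) ^ 2 = (x - 1) * (x + 1) / x ^ 2"
    using x by (simp add: field_simps power2_eq_square)
  then have "(1 / x) ^ 9 / (1 - (1 / x) ^ 2) / 9 = 1 / (9 * x ^ 7 * ((x - 1) * (x + 1)))"
    using x by (simp only:) (simp add: eval_nat_numeral)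
  moreover have "ln ((x + 1) / (x - 1))
      \<le> (\<Sum>k<4. 2 * (1 / x) ^ (2 * k + 1) / real (2 * k + 1)) + 2 * ((1 / x) ^ 9 / (1 - (1 / x) ^ 2) / 9)"
    using ln_approx_bounds[OF z, of 4] unfolding y by simp
  ultimately have "ln ((x + 1) / (x - 1))
      \<le> (\<Sum>k<4. 2 * (1 / x) ^ (2 * k + 1) / real (2 * k + 1)) + 2 * (1 / (9 * x ^ 7 * ((x - 1) * (x + 1))))"
    by simp
  then show "ln ((x + 1) / (x - 1)) / 2
      \<le> 1 / x + 1 / (3 * x ^ 3) + 1 / (5 * x ^ 5) + 1 / (7 * x ^ 7) + 1 / (9 * x ^ 7 * ((x - 1) * (x + 1)))"
    by (simp add: numeral_eq_Suc power_divide)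
qed

lemma pos_if_decreasing_tendsto_0:
  fixes d :: "nat \<Rightarrow> real"
  assumes dec: "\<And>n. n > 0 \<Longrightarrow> d (Suc n) < d n" and lim: "d \<longlonglongrightarrow> 0" and "n > 0"
  shows "d n > 0"
proof -
  \<comment> \<open>\<open>dec\<close> says nothing about index 0, so monotonicity is taken along
    the shifted sequence.\<close>
  have "decseq (\<lambda>k. d (Suc k))"
    by (intro decseq_SucI less_imp_le dec) simp
  from decseq_ge[OF this LIMSEQ_Suc[OF lim], of n] have "d (Suc n) \<ge> 0" .
  with dec[OF \<open>n > 0\<close>] show ?thesis by simp
qed

definition harm_error :: "nat \<Rightarrow> real" where
  "harm_error n = harm n - ln (2 * tri n) / 2 - euler_mascheroni"

lemma harm_error_minus_tri_approx_tendsto: "(\<lambda>n. harm_error n - tri_approx K (tri n)) \<longlonglongrightarrow> 0"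
proof -
  \<comment> \<open>Splitting off ln n isolates the limit defining Euler's constant; the rest is
    elementary, since ln n - ln (n (n + 1)) / 2 = - ln (1 + 1/n) / 2.\<close>
  have "(\<lambda>n. (harm n - ln (real n)) - euler_mascheroni
      + (ln (real n) - ln (2 * tri n) / 2 - tri_approx K (tri n))) \<longlonglongrightarrow>
      euler_mascheroni - euler_mascheroni + 0"
  proof (intro tendsto_intros euler_mascheroni_LIMSEQ)
    show "(\<lambda>n. ln (real n) - ln (2 * tri n) / 2 - tri_approx K (tri n)) \<longlonglongrightarrow> 0"
      unfolding tri_def tri_approx_def by real_asymp
  qed
  then show ?thesis
    by (simp add: harm_error_def algebra_simps)
qed

lemma harm_error_step:
  assumes "n > 0"
  defines "x \<equiv> real n + 1"
  shows "harm_error n - harm_error (Suc n) = ln ((x + 1) / (x - 1)) / 2 - 1 / x"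
proof -
  have "2 * tri (Suc n) = x * (x + 1)" "2 * tri n = x * (x - 1)"
    by (simp_all add: tri_def x_def)
  moreover have pos: "x > 0" "x - 1 > 0" "x + 1 > 0"
    using assms by (simp_all add: x_def)
  moreover have "ln ((x + 1) / (x - 1)) = ln (x + 1) - ln (x - 1)"
    using pos by (intro ln_divide_pos) auto
  moreover have "harm (Suc n) = harm n + 1 / x"
    by (simp add: harm_Suc x_def inverse_eq_divide add.commute)
  ultimately show ?thesis
    by (simp add: harm_error_def ln_mult add_divide_distrib diff_divide_distrib)
qed

lemma harm_error_bounds:
  assumes "n > 0"
  shows "tri_approx 0 (tri n) < harm_error n" "harm_error n < tri_approx (43 / 84000) (tri n)"
proof -
  \<comment> \<open>Written with \<open>real k + 1\<close> in the role of \<open>x\<close>, so that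
    the step bounds apply literally.\<close>
  have tri: "tri k = (real k + 1) * (real k + 1 - 1) / 2"
    "tri (Suc k) = (real k + 1) * (real k + 1 + 1) / 2" for k
    by (simp_all add: tri_def)
  have x: "real k + 1 \<ge> 2" "real k + 1 > 1" if "k > 0" for k
    using that by auto
  have "harm_error n - tri_approx 0 (tri n) > 0"
  proof (rule pos_if_decreasing_tendsto_0[OF _ harm_error_minus_tri_approx_tendsto assms])
    fix k :: nat assume k: "k > 0"
    show "harm_error (Suc k) - tri_approx 0 (tri (Suc k)) < harm_error k - tri_approx 0 (tri k)"
      using harm_error_step[OF k] tri_approx_step_bounds(1)[OF x(1)[OF k]]
        artanh_inverse_bounds(1)[OF x(2)[OF k]]
      unfolding tri(1)[of k] tri(2) by linarith
  qed
  then show "tri_approx 0 (tri n) < harm_error n" by simp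
  \<comment> \<open>The sign is flipped to turn the increasing difference into a decreasing
    one.\<close>
  have "- (harm_error n - tri_approx (43 / 84000) (tri n)) > 0"
  proof (rule pos_if_decreasing_tendsto_0[OF _ _ assms])
    show "(\<lambda>n. - (harm_error n - tri_approx (43 / 84000) (tri n))) \<longlonglongrightarrow> 0"
      using tendsto_minus[OF harm_error_minus_tri_approx_tendsto] by simp
    fix k :: nat assume k: "k > 0"
    show "- (harm_error (Suc k) - tri_approx (43 / 84000) (tri (Suc k)))
        < - (harm_error k - tri_approx (43 / 84000) (tri k))"
      using harm_error_step[OF k] tri_approx_step_bounds(2)[OF x(1)[OF k]]
        artanh_inverse_bounds(2)[OF x(2)[OF k]]
      unfolding tri(1)[of k] tri(2) by linarith
  qed
  then show "harm_error n < tri_approx (43 / 84000) (tri n)" by simp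
qed

lemma tri_ge:
  assumes "n > 0"
  shows "tri n \<ge> real n" "tri n \<ge> 1"
proof -
  have "real n * 2 \<le> real n * (real n + 1)"
    using assms by (intro mult_left_mono) auto
  then show "tri n \<ge> real n" by (simp add: tri_def)
  with assms show "tri n \<ge> 1" by simp
qed

text \<open>Multiplying by the k-th power of m = \<open>tri n\<close> leaves c - d/m \<le> C, and
  d/m vanishes in the limit.\<close>

lemma tri_leading_coefficient_le:
  assumes "\<And>n. n > 0 \<Longrightarrow> c / tri n ^ k - d / tri n ^ Suc k \<le> C / tri n ^ k"
  shows "c \<le> C"
proof (rule LIMSEQ_le_const2)
  show "(\<lambda>n. c - d / tri n) \<longlonglongrightarrow> c"
    unfolding tri_def by real_asymp
  have "c - d / tri n \<le> C" if "n > 0" for n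
  proof -
    have "tri n > 0" using tri_ge(2)[OF that] by simp
    with assms[OF that] have "(c - d / tri n) / tri n ^ k \<le> C / tri n ^ k"
      by (simp add: diff_divide_distrib mult.commute)
    with \<open>tri n > 0\<close> show ?thesis by (simp add: divide_le_cancel)
  qed
  then show "\<exists>N. \<forall>n\<ge>N. c - d / tri n \<le> C"
    by (intro exI[of _ 1]) auto
qed

theorem corollary1:
  "\<exists>(lam :: nat \<Rightarrow> real) (rho :: nat \<Rightarrow> real).
     (\<forall>n>0. let m = tri n in
        (harm n :: real)
          = ln (2 * m) / 2 + euler_mascheroni + 1 / (12 * m + 6 / 5) + lam n
        \<and> 0 < lam n \<and> lam n < 19 / (25200 * m ^ 3)
        \<and> lam n = 19 / (25200 * m ^ 3) - rho n
        \<and> 0 < rho n \<and> rho n < 43 / (84000 * m ^ 4))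
     \<and> \<not> (\<exists>C::real. C < 19 / 25200 \<and> (\<forall>n>0. lam n < C / tri n ^ 3))
     \<and> \<not> (\<exists>C'::real. C' < 43 / 84000 \<and> (\<forall>n>0. rho n < C' / tri n ^ 4))"
proof -
  define lam where "lam n = harm_error n - 1 / (12 * tri n + 6 / 5)" for n
  define rho where "rho n = 19 / (25200 * tri n ^ 3) - lam n" for n
  \<comment> \<open>Subtraction reverses the bounds: \<open>tri_approx 0\<close> bounds
    \<open>rho\<close> from above, and the term K / m^5 provides the bound from below.\<close>
  have rho_upper: "rho n < 43 / 84000 / tri n ^ 4"
    and rho_lower: "rho n > 43 / 84000 / tri n ^ 4 - 43 / 84000 / tri n ^ 5" if "n > 0" for n
    using harm_error_bounds[OF that] by (simp_all add: rho_def lam_def tri_approx_def)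
  have main: "0 < lam n \<and> 0 < rho n" if "n > 0" for n
  proof
    have m: "tri n \<ge> 1" using tri_ge(2)[OF that] .
    \<comment> \<open>Since K equals the m^-4 coefficient, m \<ge> 1 suffices for the K / m^5 term
      to be absorbed.\<close>
    have "43 / 84000 / tri n ^ 5 \<le> 43 / 84000 / tri n ^ 4"
      using m by (intro divide_left_mono power_increasing) (auto intro!: zero_less_power mult_pos_pos)
    with rho_lower[OF that] show "0 < rho n" by linarith
    have "43 / 84000 / tri n ^ 4 \<le> 19 / 25200 / tri n ^ 3"
      by (rule frac_le[OF _ _ _ power_increasing[OF _ m]]) (use m in \<open>auto intro!: zero_less_power\<close>)
    with rho_upper[OF that] show "0 < lam n" by (simp add: rho_def)
  qed
  have "let m = tri n in
        (harm n :: real)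
          = ln (2 * m) / 2 + euler_mascheroni + 1 / (12 * m + 6 / 5) + lam n
        \<and> 0 < lam n \<and> lam n < 19 / (25200 * m ^ 3)
        \<and> lam n = 19 / (25200 * m ^ 3) - rho n
        \<and> 0 < rho n \<and> rho n < 43 / (84000 * m ^ 4)" if "n > 0" for n
    using main[OF that] rho_upper[OF that] by (simp add: Let_def rho_def lam_def harm_error_def)
  \<comment> \<open>The upper bound on \<open>rho\<close> is a lower bound on \<open>lam\<close>
    with leading term 19 / (25200 m^3).\<close>
  moreover have "19 / 25200 \<le> C" if C: "\<forall>n>0. lam n < C / tri n ^ 3" for C
  proof (rule tri_leading_coefficient_le)
    fix n :: nat assume n: "n > 0"
    show "19 / 25200 / tri n ^ 3 - 43 / 84000 / tri n ^ Suc 3 \<le> C / tri n ^ 3"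
      using rho_upper[OF n] C[rule_format, OF n] by (simp add: rho_def)
  qed
  moreover have "43 / 84000 \<le> C" if C: "\<forall>n>0. rho n < C / tri n ^ 4" for C
  proof (rule tri_leading_coefficient_le)
    fix n :: nat assume n: "n > 0"
    show "43 / 84000 / tri n ^ 4 - 43 / 84000 / tri n ^ Suc 4 \<le> C / tri n ^ 4"
      using rho_lower[OF n] C[rule_format, OF n] by simp
  qed
  ultimately show ?thesis
    by (intro exI[of _ lam] exI[of _ rho]) (meson not_le)
qed

end
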